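(* Let $b^{*}>0$, let $f:I\subset[0,b^{*}]\to\mathbb{R}$ be a differentiable function on $I^{\circ}$ such that $f'''\in L[a,b]$, where $a,b\in I$ with $a<b$. Let $q>1$ and let $p$ be given by $\frac1p+\frac1q=1$. If $|f'''|^{q}$ is $m$-convex on $[a,b]$ for $m\in(0,1]$, then the following inequality holds: $$\left|\int_{a}^{mb}f(x)\,dx-\frac{mb-a}{6}\left[f(a)+4f\left(\frac{a+b}{2}\right)+f(mb)\right]\right|$$ $$\le\frac{(mb-a)^{4}}{96}\left(\frac{\Gamma(2p+1)\Gamma(p+1)}{\Gamma(3p+1)}\right)^{\frac1p}\left\{\left(\frac{|f'''(a)|^{q}+3m|f'''(b)|^{q}}{4}\right)^{\frac1q}+\left(\frac{3|f'''(a)|^{q}+m|f'''(b)|^{q}}{4}\right)^{\frac1q}\right\}.$$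
   Context: $I$ is an interval and $I^{\circ}$ is its interior; $L[a,b]$ denotes the space of integrable functions on $[a,b]$; $\Gamma$ is the Gamma function. $m$-convexity (Toader): for $m\in[0,1]$, a function $g:[0,b]\to\mathbb{R}$ is said to be $m$-convex if $g(tx+m(1-t)y)\le t\,g(x)+m(1-t)\,g(y)$ for every $x,y\in[0,b]$ and $t\in[0,1]$. "$m$-convex on $[a,b]$" refers to this inequality for $x,y\in[a,b]$ and $t\in[0,1]$.
   Formalization: The node (a+b)/2 is corrected to (a+mb)/2, since the printed inequality fails for f(x)=x when m<1 and mb≠a; mb∈I is assumed, and f is three times differentiable on I° and at a, b, mb (one-sided at endpoints of I). *)

theory Defs
  imports "HOL-Analysis.Analysis"
begin

text \<open>
  The inequality also evaluates \<open>g\<close> at points below \<open>S\<close> when \<open>S = {a..b}\<close> with \<open>a > 0\<close> and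
  \<open>m < 1\<close>; \<open>S\<close> only restricts \<open>x\<close> and \<open>y\<close>.
\<close>

definition m_convex_on :: "real \<Rightarrow> real set \<Rightarrow> (real \<Rightarrow> real) \<Rightarrow> bool" where
  "m_convex_on m S g \<longleftrightarrow>
     (\<forall>x\<in>S. \<forall>y\<in>S. \<forall>t\<in>{0..1}. g (t * x + m * (1 - t) * y) \<le> t * g x + m * (1 - t) * g y)"

end

theory Submission
  imports Defs
begin

text \<open>
  Put \<open>c = m * b\<close> and let \<open>d\<close> be the midpoint of \<open>a\<close> and \<open>c\<close>. The error of Simpson's rule on
  the segment from \<open>a\<close> to \<open>c\<close> is the integral of \<open>f3\<close> against a piecewise cubic Peano kernel,
  which is symmetric about \<open>d\<close> up to sign. The two halves are therefore the same object: after an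
  affine change of variable that sends an endpoint \<open>u \<in> {a, c}\<close> to \<open>0\<close> and \<open>d\<close> to \<open>1\<close>, integration
  by parts against the kernel \<open>s\<^sup>2 * (s - 1)\<close> gives half of Simpson's rule
  (\<open>half_Simpson_error\<close>), up to a boundary term \<open>(d - u)\<^sup>2 * f1 d\<close>. That term has the same value for
  \<open>u = a\<close> and \<open>u = c\<close>, so it cancels when the two halves are subtracted.

  On each half Hoelder's inequality separates the kernel from \<open>f3\<close>. The \<open>p\<close>-th power of the
  kernel integrates to \<open>Beta (2 * p + 1) (p + 1)\<close>, whose denominator \<open>Gamma (3 * p + 2)\<close> is at
  least \<open>Gamma (3 * p + 1)\<close>. The \<open>m\<close>-convexity of \<open>\<bar>f3\<bar> powr q\<close>, used with the points \<open>a\<close> and \<open>b\<close>,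
  bounds it on the segment by the affine function with the values \<open>\<bar>f3 a\<bar> powr q\<close> at \<open>a\<close> and
  \<open>m * \<bar>f3 b\<bar> powr q\<close> at \<open>c\<close>; the means of this function over the two halves are the two
  terms with denominator \<open>4\<close>. The constant is \<open>1 / 96 = 1 / 6 * (1 / 2) ^ 4\<close>: each half has length
  \<open>\<bar>c - a\<bar> / 2\<close>, which enters to the fourth power.

  The point \<open>c\<close> may lie on either side of \<open>a\<close>. All estimates on a half are therefore stated for a
  directed segment from \<open>u\<close> to \<open>d\<close>, without an order between its ends.
\<close>

section \<open>Hoelder's inequality for the gauge integral\<close>

text \<open>
  Young's inequality for \<open>u / c\<close> and \<open>v / d\<close>, with \<open>c\<close> and \<open>d\<close> close to the \<open>p\<close>- and \<open>q\<close>-norms,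
  integrates to the claim up to an error. Enlarging both integrals by \<open>e > 0\<close> before taking roots
  avoids a division by zero; then \<open>e\<close> tends to \<open>0\<close>.
\<close>
lemma Holder_inequality_integral:
  fixes u v :: "'n::euclidean_space \<Rightarrow> real"
  assumes p: "p > 1" and q: "q > 1" and pq: "1 / p + 1 / q = 1"
    and u: "\<And>x. x \<in> S \<Longrightarrow> u x \<ge> 0" and v: "\<And>x. x \<in> S \<Longrightarrow> v x \<ge> 0"
    and iu: "(\<lambda>x. u x powr p) integrable_on S"
    and iv: "(\<lambda>x. v x powr q) integrable_on S"
    and iuv: "(\<lambda>x. u x * v x) integrable_on S"
  shows "integral S (\<lambda>x. u x * v x)
         \<le> integral S (\<lambda>x. u x powr p) powr (1 / p) * integral S (\<lambda>x. v x powr q) powr (1 / q)"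
proof -
  define A where "A = integral S (\<lambda>x. u x powr p)"
  define B where "B = integral S (\<lambda>x. v x powr q)"
  have A: "A \<ge> 0" and B: "B \<ge> 0"
    unfolding A_def B_def by (auto intro!: integral_nonneg iu iv)
  have bound: "integral S (\<lambda>x. u x * v x) \<le> (A + e) powr (1 / p) * (B + e) powr (1 / q)"
    if e: "e > 0" for e
  proof -
    define c where "c = (A + e) powr (1 / p)"
    define d where "d = (B + e) powr (1 / q)"
    have c: "c > 0" and d: "d > 0"
      using A B e by (auto simp: c_def d_def)
    have cp: "c powr p = A + e" and dq: "d powr q = B + e"
      using A B e p q by (auto simp: c_def d_def powr_powr)
    have pt: "u x * v x \<le> c * d * ((u x powr p) / (p * (A + e)) + (v x powr q) / (q * (B + e)))"
      if "x \<in> S" for x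
    proof -
      have "(u x / c) * (v x / d) \<le> (u x / c) powr p / p + (v x / d) powr q / q"
        by (intro Youngs_inequality p q pq) (use u v c d that in auto)
      also have "\<dots> = (u x powr p) / (p * (A + e)) + (v x powr q) / (q * (B + e))"
        using u v c d that by (simp add: powr_divide cp dq mult.commute)
      finally show ?thesis
        using c d by (simp add: field_simps)
    qed
    have "integral S (\<lambda>x. u x * v x)
        \<le> integral S (\<lambda>x. c * d * ((u x powr p) / (p * (A + e)) + (v x powr q) / (q * (B + e))))"
      by (intro integral_le iuv pt integrable_on_mult_right integrable_add integrable_on_divide iu iv)
    also have "\<dots> = c * d * (A / (p * (A + e)) + B / (q * (B + e)))"
      by (simp add: integral_add integrable_on_divide iu iv A_def B_def)
    also have "\<dots> \<le> c * d * (1 / p + 1 / q)"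
    proof (intro mult_left_mono add_mono)
      show "A / (p * (A + e)) \<le> 1 / p" "B / (q * (B + e)) \<le> 1 / q"
        using A B e p q by (simp_all add: frac_le_eq divide_le_eq)
    qed (use c d in auto)
    finally show ?thesis
      by (simp add: pq c_def d_def)
  qed
  have lim: "((\<lambda>e. (D + e) powr (1 / r)) \<longlongrightarrow> (D + 0) powr (1 / r)) (at_right 0)"
    if "D \<ge> 0" "r > 1" for D r :: real
    by (rule tendsto_powr' tendsto_intros)+
       (use that in \<open>auto intro!: eventually_at_rightI[of 0 1]\<close>)
  have "((\<lambda>e. (A + e) powr (1 / p) * (B + e) powr (1 / q))
          \<longlongrightarrow> (A + 0) powr (1 / p) * (B + 0) powr (1 / q)) (at_right 0)"
    by (intro tendsto_mult lim A B p q)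
  then have "integral S (\<lambda>x. u x * v x) \<le> (A + 0) powr (1 / p) * (B + 0) powr (1 / q)"
    by (rule tendsto_lowerbound) (rule eventually_at_rightI[of 0 1], auto intro: bound)
  then show ?thesis
    by (simp add: A_def B_def)
qed

section \<open>Simpson's rule on half an interval\<close>

text \<open>
  The kernel \<open>K s = s\<^sup>2 * (s - 1)\<close> has third derivative \<open>6\<close> and is chosen so that \<open>K\<close> vanishes at both
  ends and \<open>K'\<close> vanishes at \<open>0\<close>: three integrations by parts then leave the values of \<open>g\<close> at the ends
  with weights in the ratio \<open>1 : 2\<close> and, of the derivatives, only \<open>g1 1\<close>.
  They are done at once by the primitive \<open>K * g2 - K' * g1 + K'' * g\<close> of \<open>K * g3 + 6 * g\<close>. In this
  form the fundamental theorem for the gauge integral makes the kernel integral exist for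
  every derivative \<open>g3\<close>.
\<close>
lemma half_Simpson_error:
  fixes g g1 g2 g3 :: "real \<Rightarrow> real"
  assumes g: "\<And>s. s \<in> {0..1} \<Longrightarrow> (g has_real_derivative g1 s) (at s within {0..1})"
    and g1: "\<And>s. s \<in> {0..1} \<Longrightarrow> (g1 has_real_derivative g2 s) (at s within {0..1})"
    and g2: "\<And>s. s \<in> {0..1} \<Longrightarrow> (g2 has_real_derivative g3 s) (at s within {0..1})"
  shows "((\<lambda>s. s\<^sup>2 * (s - 1) * g3 s) has_integral
           4 * g 1 + 2 * g 0 - g1 1 - 6 * integral {0..1} g) {0..1}"
proof -
  define F where "F s = s\<^sup>2 * (s - 1) * g2 s - (3 * s\<^sup>2 - 2 * s) * g1 s + (6 * s - 2) * g s" for s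
  have "(F has_real_derivative s\<^sup>2 * (s - 1) * g3 s + 6 * g s) (at s within {0..1})"
    if "s \<in> {0..1}" for s
    unfolding F_def using that
    by (auto intro!: derivative_eq_intros g g1 g2 simp: algebra_simps power2_eq_square)
  then have F: "((\<lambda>s. s\<^sup>2 * (s - 1) * g3 s + 6 * g s) has_integral F 1 - F 0) {0..1}"
    by (intro fundamental_theorem_of_calculus)
       (auto simp: has_real_derivative_iff_has_vector_derivative)
  have "continuous_on {0..1} g"
    using g DERIV_continuous_on by blast
  then have "(g has_integral integral {0..1} g) {0..1}"
    by (intro integrable_integral integrable_continuous_real)
  from has_integral_diff[OF F has_integral_mult_right[OF this, of 6]]
  show ?thesis
    by (simp add: F_def algebra_simps)
qed

text \<open>
  Hoelder's inequality is applied to the kernel and the \<open>q\<close>-th root of the affine majorant \<open>w\<close> of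
  \<open>\<bar>g3\<bar> powr q\<close>, and not to \<open>g3\<close> itself. All functions in it are then continuous, so integrability
  is immediate.
\<close>
lemma half_Simpson_bound:
  fixes g g1 g2 g3 :: "real \<Rightarrow> real"
  assumes p: "p > 1" and q: "q > 1" and pq: "1 / p + 1 / q = 1"
    and g: "\<And>s. s \<in> {0..1} \<Longrightarrow> (g has_real_derivative g1 s) (at s within {0..1})"
    and g1: "\<And>s. s \<in> {0..1} \<Longrightarrow> (g1 has_real_derivative g2 s) (at s within {0..1})"
    and g2: "\<And>s. s \<in> {0..1} \<Longrightarrow> (g2 has_real_derivative g3 s) (at s within {0..1})"
    and g3: "\<And>s. s \<in> {0..1} \<Longrightarrow> \<bar>g3 s\<bar> powr q \<le> (1 - s) * \<alpha> + s * \<beta>"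
  shows "\<bar>6 * integral {0..1} g - 4 * g 1 - 2 * g 0 + g1 1\<bar>
         \<le> Beta (2 * p + 1) (p + 1) powr (1 / p) * ((\<alpha> + \<beta>) / 2) powr (1 / q)"
proof -
  define k where "k s = s\<^sup>2 * (1 - s)" for s :: real
  define w where "w s = (1 - s) * \<alpha> + s * \<beta>" for s
  have k0: "k s \<ge> 0" and w0: "w s \<ge> 0" if "s \<in> {0..1}" for s
    using that order_trans[OF powr_ge_zero g3] by (auto simp: k_def w_def)
  have g3w: "\<bar>g3 s\<bar> \<le> w s powr (1 / q)" if "s \<in> {0..1}" for s
  proof -
    have "(\<bar>g3 s\<bar> powr q) powr (1 / q) \<le> w s powr (1 / q)"
      using g3[OF that] q by (intro powr_mono2) (auto simp: w_def)
    then show ?thesis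
      using q by (simp add: powr_powr)
  qed
  have contw: "continuous_on {0..1} w" and contk: "continuous_on {0..1} k"
    unfolding w_def k_def by (auto intro!: continuous_intros)
  have int_kw: "(\<lambda>s. k s * w s powr (1 / q)) integrable_on {0..1}"
    by (intro integrable_continuous_real continuous_on_mult contk continuous_on_powr' contw)
       (use w0 q in auto)
  have "((\<lambda>s. s powr (2 * p + 1 - 1) * (1 - s) powr (p + 1 - 1))
           has_integral Beta (2 * p + 1) (p + 1)) {0..1}"
    using p by (intro has_integral_Beta_real) auto
  then have int_k: "((\<lambda>s. k s powr p) has_integral Beta (2 * p + 1) (p + 1)) {0..1}"
  proof (rule has_integral_eq[rotated])
    fix s :: real assume "s \<in> {0..1}"
    then show "s powr (2 * p + 1 - 1) * (1 - s) powr (p + 1 - 1) = k s powr p"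
      by (cases "s = 0") (auto simp: k_def powr_mult powr_powr simp flip: powr_numeral)
  qed
  have "((\<lambda>s. s * \<alpha> - s\<^sup>2 / 2 * \<alpha> + s\<^sup>2 / 2 * \<beta>) has_real_derivative w s) (at s within {0..1})" for s
    by (auto intro!: derivative_eq_intros simp: w_def algebra_simps)
  then have "(w has_integral (1 * \<alpha> - 1\<^sup>2 / 2 * \<alpha> + 1\<^sup>2 / 2 * \<beta>) - (0 * \<alpha> - 0\<^sup>2 / 2 * \<alpha> + 0\<^sup>2 / 2 * \<beta>)) {0..1}"
    by (intro fundamental_theorem_of_calculus)
       (auto simp: has_real_derivative_iff_has_vector_derivative)
  then have "(w has_integral (\<alpha> + \<beta>) / 2) {0..1}"
    by (simp add: field_simps)
  then have int_w: "((\<lambda>s. (w s powr (1 / q)) powr q) has_integral (\<alpha> + \<beta>) / 2) {0..1}"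
    by (rule has_integral_eq[rotated]) (use q w0 in \<open>simp add: powr_powr\<close>)
  have err: "((\<lambda>s. s\<^sup>2 * (s - 1) * g3 s) has_integral
           4 * g 1 + 2 * g 0 - g1 1 - 6 * integral {0..1} g) {0..1}"
    by (rule half_Simpson_error[OF g g1 g2])
  have "\<bar>6 * integral {0..1} g - 4 * g 1 - 2 * g 0 + g1 1\<bar>
      = norm (integral {0..1} (\<lambda>s. s\<^sup>2 * (s - 1) * g3 s))"
    unfolding integral_unique[OF err] by simp
  also have "\<dots> \<le> integral {0..1} (\<lambda>s. k s * w s powr (1 / q))"
  proof (rule integral_norm_bound_integral)
    show "(\<lambda>s. s\<^sup>2 * (s - 1) * g3 s) integrable_on {0..1}"
      using err by (rule has_integral_integrable)
    fix s :: real assume s: "s \<in> {0..1}"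
    have "norm (s\<^sup>2 * (s - 1) * g3 s) = k s * \<bar>g3 s\<bar>"
      using s by (simp add: k_def abs_mult)
    also have "\<dots> \<le> k s * w s powr (1 / q)"
      by (intro mult_left_mono g3w k0 s)
    finally show "norm (s\<^sup>2 * (s - 1) * g3 s) \<le> k s * w s powr (1 / q)" .
  qed (rule int_kw)
  also have "\<dots> \<le> integral {0..1} (\<lambda>s. k s powr p) powr (1 / p)
      * integral {0..1} (\<lambda>s. (w s powr (1 / q)) powr q) powr (1 / q)"
    by (intro Holder_inequality_integral p q pq int_kw k0 has_integral_integrable[OF int_k]
          has_integral_integrable[OF int_w]) auto
  finally show ?thesis
    by (simp only: integral_unique[OF int_k] integral_unique[OF int_w])
qed

text \<open>
  The bound for \<open>g s = f (u + s * (d - u))\<close>. The third derivative of \<open>g\<close> contributes the factor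
  \<open>(d - u) ^ 3\<close> and the change of variable in the integral the fourth.
\<close>
lemma segment_Simpson_bound:
  fixes f f1 f2 f3 :: "real \<Rightarrow> real"
  assumes p: "p > 1" and q: "q > 1" and pq: "1 / p + 1 / q = 1"
    and f: "\<And>x. x \<in> closed_segment u d \<Longrightarrow> (f has_real_derivative f1 x) (at x within closed_segment u d)"
    and f1: "\<And>x. x \<in> closed_segment u d \<Longrightarrow> (f1 has_real_derivative f2 x) (at x within closed_segment u d)"
    and f2: "\<And>x. x \<in> closed_segment u d \<Longrightarrow> (f2 has_real_derivative f3 x) (at x within closed_segment u d)"
    and f3: "\<And>s. s \<in> {0..1} \<Longrightarrow> \<bar>f3 (u + s * (d - u))\<bar> powr q \<le> (1 - s) * \<alpha> + s * \<beta>"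
  shows "\<bar>6 * (LBINT x=u..d. f x) - (d - u) * (4 * f d + 2 * f u) + (d - u)\<^sup>2 * f1 d\<bar>
         \<le> (d - u) ^ 4 * Beta (2 * p + 1) (p + 1) powr (1 / p) * ((\<alpha> + \<beta>) / 2) powr (1 / q)"
proof -
  define h where "h = d - u"
  define \<phi> where "\<phi> s = u + s * h" for s
  have \<phi>_image: "\<phi> ` {0..1} = closed_segment u d"
    by (auto simp: \<phi>_def h_def closed_segment_def image_def algebra_simps)
  have \<phi>_deriv: "(\<phi> has_real_derivative h) (at s within {0..1})" for s
    unfolding \<phi>_def by (auto intro!: derivative_eq_intros)
  have chain: "((\<lambda>s. h ^ n * F (\<phi> s)) has_real_derivative h ^ Suc n * F' (\<phi> s)) (at s within {0..1})"
    if F: "\<And>x. x \<in> closed_segment u d \<Longrightarrow> (F has_real_derivative F' x) (at x within closed_segment u d)"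
      and s: "s \<in> {0..1}" for F F' n s
  proof -
    have "(F has_real_derivative F' (\<phi> s)) (at (\<phi> s) within \<phi> ` {0..1})"
      unfolding \<phi>_image by (rule F) (use s in \<open>auto simp flip: \<phi>_image\<close>)
    from DERIV_image_chain[OF this \<phi>_deriv]
    have "((\<lambda>s. F (\<phi> s)) has_real_derivative F' (\<phi> s) * h) (at s within {0..1})"
      by (simp add: o_def)
    from DERIV_cmult[OF this, of "h ^ n"] show ?thesis
      by (simp add: mult_ac)
  qed
  have ends: "\<phi> 0 = u" "\<phi> 1 = d"
    by (auto simp: \<phi>_def h_def)
  have contf: "continuous_on (\<phi> ` {0..1}) f"
    unfolding \<phi>_image using f DERIV_continuous_on by blast
  have contf\<phi>: "continuous_on {0..1} (\<lambda>s. f (\<phi> s))"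
    by (rule continuous_on_compose2[OF contf]) (auto simp: \<phi>_def intro!: continuous_intros)
  have "(LBINT x=u..d. f x) = (LBINT s=0..1. h * f (\<phi> s))"
    using interval_integral_substitution_finite[of 0 1 \<phi> "\<lambda>_. h" f] \<phi>_deriv contf
    by (simp add: ends zero_ereal_def one_ereal_def)
  also have "\<dots> = h * (LBINT s=0..1. f (\<phi> s))"
    by simp
  also have "(LBINT s=0..1. f (\<phi> s)) = integral {0..1} (\<lambda>s. f (\<phi> s))"
    using interval_integral_eq_integral[of 0 1 "\<lambda>s. f (\<phi> s)"]
      borel_integrable_atLeastAtMost'[OF contf\<phi>]
    by (simp add: zero_ereal_def one_ereal_def)
  finally have LB: "(LBINT x=u..d. f x) = h * integral {0..1} (\<lambda>s. f (\<phi> s))" .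
  \<comment> \<open>the factor \<open>h ^ 3\<close> of the third derivative of \<open>f \<circ> \<phi>\<close> is moved into the end values of
     the majorant, and comes out again below as \<open>\<bar>h\<bar> ^ 3\<close> under the \<open>q\<close>-th root\<close>
  have scale: "\<bar>h ^ 3 * f3 (\<phi> s)\<bar> powr q
      \<le> (1 - s) * (\<bar>h ^ 3\<bar> powr q * \<alpha>) + s * (\<bar>h ^ 3\<bar> powr q * \<beta>)" if "s \<in> {0..1}" for s
    using mult_left_mono[OF f3[OF that], of "\<bar>h ^ 3\<bar> powr q"]
    by (simp add: abs_mult powr_mult \<phi>_def h_def algebra_simps)
  have \<alpha>\<beta>: "\<alpha> \<ge> 0" "\<beta> \<ge> 0"
    using order_trans[OF powr_ge_zero f3, of 0] order_trans[OF powr_ge_zero f3, of 1] by auto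
  have "\<bar>6 * integral {0..1} (\<lambda>s. f (\<phi> s)) - 4 * f (\<phi> 1) - 2 * f (\<phi> 0) + h * f1 (\<phi> 1)\<bar>
      \<le> Beta (2 * p + 1) (p + 1) powr (1 / p)
        * ((\<bar>h ^ 3\<bar> powr q * \<alpha> + \<bar>h ^ 3\<bar> powr q * \<beta>) / 2) powr (1 / q)"
    using half_Simpson_bound[OF p q pq, of "\<lambda>s. f (\<phi> s)" "\<lambda>s. h * f1 (\<phi> s)" "\<lambda>s. h\<^sup>2 * f2 (\<phi> s)"
        "\<lambda>s. h ^ 3 * f3 (\<phi> s)", OF _ _ _ scale]
      chain[OF f, where n = 0] chain[OF f1, where n = 1] chain[OF f2, where n = 2]
    by (simp add: numeral_eq_Suc)
  also have "(\<bar>h ^ 3\<bar> powr q * \<alpha> + \<bar>h ^ 3\<bar> powr q * \<beta>) / 2 = \<bar>h ^ 3\<bar> powr q * ((\<alpha> + \<beta>) / 2)"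
    by (simp add: field_simps)
  also have "(\<bar>h ^ 3\<bar> powr q * ((\<alpha> + \<beta>) / 2)) powr (1 / q) = \<bar>h\<bar> ^ 3 * ((\<alpha> + \<beta>) / 2) powr (1 / q)"
    using q \<alpha>\<beta> by (subst powr_mult) (auto simp: powr_powr power_abs)
  finally have "\<bar>h\<bar> * \<bar>6 * integral {0..1} (\<lambda>s. f (\<phi> s)) - 4 * f d - 2 * f u + h * f1 d\<bar>
      \<le> \<bar>h\<bar> * (Beta (2 * p + 1) (p + 1) powr (1 / p) * (\<bar>h\<bar> ^ 3 * ((\<alpha> + \<beta>) / 2) powr (1 / q)))"
    unfolding ends by (intro mult_left_mono) auto
  also have "\<dots> = \<bar>h\<bar> ^ 4 * Beta (2 * p + 1) (p + 1) powr (1 / p) * ((\<alpha> + \<beta>) / 2) powr (1 / q)"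
    by (simp add: numeral_eq_Suc)
  also have "\<bar>h\<bar> ^ 4 = h ^ 4"
    by (simp add: power_even_abs)
  also have "\<bar>h\<bar> * \<bar>6 * integral {0..1} (\<lambda>s. f (\<phi> s)) - 4 * f d - 2 * f u + h * f1 d\<bar>
      = \<bar>6 * (LBINT x=u..d. f x) - h * (4 * f d + 2 * f u) + h\<^sup>2 * f1 d\<bar>"
    unfolding LB abs_mult[symmetric] by (simp add: algebra_simps power2_eq_square)
  finally show ?thesis
    by (simp add: h_def)
qed

section \<open>Simpson's inequality under \<open>m\<close>-convexity\<close>

text \<open>
  Since \<open>Gamma (3 * p + 2) = (3 * p + 1) * Gamma (3 * p + 1)\<close>, the right-hand side exceeds the left
  by the factor \<open>3 * p + 1\<close>.
\<close>
lemma Beta_le_Gamma_ratio: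
  fixes p :: real
  assumes "p > 0"
  shows "Beta (2 * p + 1) (p + 1) \<le> Gamma (2 * p + 1) * Gamma (p + 1) / Gamma (3 * p + 1)"
proof -
  have "Gamma (3 * p + 1 + 1) = (3 * p + 1) * Gamma (3 * p + 1)"
    using assms by (intro Gamma_plus1) (auto elim!: nonpos_Ints_cases')
  moreover have "1 * Gamma (3 * p + 1) \<le> (3 * p + 1) * Gamma (3 * p + 1)"
    using assms by (intro mult_right_mono) auto
  ultimately have "Gamma (3 * p + 1) \<le> Gamma (2 * p + 1 + (p + 1))"
    by (simp add: algebra_simps)
  then show ?thesis
    using assms unfolding Beta_def by (intro divide_left_mono mult_pos_pos mult_nonneg_nonneg) auto
qed

theorem theorem4:
  fixes f f1 f2 f3 :: "real \<Rightarrow> real" and I :: "real set" and bstar a b m p q :: real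
  assumes "bstar > 0"
    and "is_interval I" and "I \<subseteq> {0..bstar}"
    and "a \<in> I" and "b \<in> I" and "a < b" and "m * b \<in> I"
    and "\<And>x. x \<in> interior I \<union> {a, b, m * b} \<Longrightarrow> (f has_real_derivative f1 x) (at x within I)"
    and "\<And>x. x \<in> interior I \<union> {a, b, m * b} \<Longrightarrow> (f1 has_real_derivative f2 x) (at x within I)"
    and "\<And>x. x \<in> interior I \<union> {a, b, m * b} \<Longrightarrow> (f2 has_real_derivative f3 x) (at x within I)"
    and "f3 absolutely_integrable_on {a..b}"
    and "q > 1" and "1 / p + 1 / q = 1"
    and "0 < m" and "m \<le> 1"
    and "m_convex_on m {a..b} (\<lambda>x. \<bar>f3 x\<bar> powr q)"
  shows "\<bar>(LBINT x=a..m * b. f x)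
            - (m * b - a) / 6 * (f a + 4 * f ((a + m * b) / 2) + f (m * b))\<bar>
         \<le> (m * b - a) ^ 4 / 96
            * (Gamma (2 * p + 1) * Gamma (p + 1) / Gamma (3 * p + 1)) powr (1 / p)
            * (((\<bar>f3 a\<bar> powr q + 3 * m * \<bar>f3 b\<bar> powr q) / 4) powr (1 / q)
               + ((3 * \<bar>f3 a\<bar> powr q + m * \<bar>f3 b\<bar> powr q) / 4) powr (1 / q))"
proof -
  define c where "c = m * b"
  define d where "d = (a + c) / 2"
  define h where "h = (c - a) / 2"
  define A where "A = \<bar>f3 a\<bar> powr q"
  define B where "B = m * \<bar>f3 b\<bar> powr q"
  define C where "C = Beta (2 * p + 1) (p + 1) powr (1 / p)"
  have q: "q > 1" and pq: "1 / p + 1 / q = 1"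
    by fact+
  have "1 / q < 1" "1 / q > 0"
    using q by auto
  then have "1 / p > 0" "1 / p < 1"
    using pq by linarith+
  then have p: "p > 1"
    by (simp add: divide_less_eq split: if_splits)
  have seg_I: "closed_segment a c \<subseteq> I"
    using assms(2,4,7) by (simp add: c_def closed_segment_subset is_interval_convex)
  then have "open_segment a c \<subseteq> interior I"
    by (intro interior_maximal) (auto simp: open_segment_eq_real_ivl closed_segment_eq_real_ivl)
  then have seg: "closed_segment a c \<subseteq> interior I \<union> {a, b, c}"
    by (auto simp: open_segment_def)
  have d_seg: "d \<in> closed_segment a c"
    unfolding d_def using midpoint_in_closed_segment[of a c] by (simp add: midpoint_def)
  \<comment> \<open>every point strictly between \<open>a\<close> and \<open>c\<close> is interior to \<open>I\<close>, so the derivatives exist on the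
     whole segment\<close>
  have restrict: "(F has_real_derivative F' x) (at x within closed_segment u d)"
    if "\<And>x. x \<in> interior I \<union> {a, b, m * b} \<Longrightarrow> (F has_real_derivative F' x) (at x within I)"
      and "x \<in> closed_segment u d" and "u \<in> {a, c}" for F F' x u
  proof -
    have sub: "closed_segment u d \<subseteq> closed_segment a c"
      using d_seg that(3) by (intro closed_segment_subset) auto
    show ?thesis
      by (rule DERIV_subset[OF that(1)]) (use that(2) sub seg seg_I in \<open>auto simp: c_def\<close>)
  qed
  have conv: "\<bar>f3 (t * a + (1 - t) * c)\<bar> powr q \<le> t * A + (1 - t) * B" if "t \<in> {0..1}" for t
    using assms(16) that \<open>a < b\<close> unfolding m_convex_on_def A_def B_def c_def
    by (force simp: mult_ac)
  have left: "\<bar>6 * (LBINT x=a..d. f x) - (d - a) * (4 * f d + 2 * f a) + (d - a)\<^sup>2 * f1 d\<bar>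
      \<le> (d - a) ^ 4 * C * ((A + (A + B) / 2) / 2) powr (1 / q)"
    unfolding C_def
  proof (intro segment_Simpson_bound p q pq)
    fix s :: real assume "s \<in> {0..1}"
    then show "\<bar>f3 (a + s * (d - a))\<bar> powr q \<le> (1 - s) * A + s * ((A + B) / 2)"
      using conv[of "1 - s / 2"] by (simp add: d_def field_simps)
  qed (erule restrict[rotated], simp, fact)+
  have right: "\<bar>6 * (LBINT x=c..d. f x) - (d - c) * (4 * f d + 2 * f c) + (d - c)\<^sup>2 * f1 d\<bar>
      \<le> (d - c) ^ 4 * C * ((B + (A + B) / 2) / 2) powr (1 / q)"
    unfolding C_def
  proof (intro segment_Simpson_bound p q pq)
    fix s :: real assume "s \<in> {0..1}"
    then show "\<bar>f3 (c + s * (d - c))\<bar> powr q \<le> (1 - s) * B + s * ((A + B) / 2)"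
      using conv[of "s / 2"] by (simp add: d_def field_simps)
  qed (erule restrict[rotated], simp, fact)+
  have "continuous_on {min a c..max a c} f"
  proof (rule DERIV_continuous_on)
    fix x assume "x \<in> {min a c..max a c}"
    then have x: "x \<in> closed_segment a c"
      by (auto simp: closed_segment_eq_real_ivl)
    show "(f has_real_derivative f1 x) (at x within {min a c..max a c})"
      by (rule DERIV_subset[OF assms(8)])
         (use x seg seg_I in \<open>auto simp: c_def closed_segment_eq_real_ivl split: if_splits\<close>)
  qed
  then have "interval_lebesgue_integrable lborel (min a c) (max a c) f"
    by (intro interval_integrable_continuous_on) auto
  then have "(LBINT x=a..d. f x) + (LBINT x=d..c. f x) = (LBINT x=a..c. f x)"
    by (intro interval_integral_sum)
       (auto simp: d_def min_def max_def split: if_splits)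
  then have split: "(LBINT x=a..c. f x) = (LBINT x=a..d. f x) - (LBINT x=c..d. f x)"
    using interval_integral_endpoints_reverse[of c d f] by simp
  have h: "d - a = h" "d - c = - h" "c - a = 2 * h"
    by (auto simp: d_def h_def field_simps)
  \<comment> \<open>the two terms with \<open>f1 d\<close> cancel because \<open>(d - a)\<^sup>2 = (d - c)\<^sup>2\<close>\<close>
  have "6 * ((LBINT x=a..c. f x) - (c - a) / 6 * (f a + 4 * f d + f c))
      = (6 * (LBINT x=a..d. f x) - (d - a) * (4 * f d + 2 * f a) + (d - a)\<^sup>2 * f1 d)
        - (6 * (LBINT x=c..d. f x) - (d - c) * (4 * f d + 2 * f c) + (d - c)\<^sup>2 * f1 d)"
    unfolding split h by (simp add: algebra_simps)
  then have "\<bar>6 * ((LBINT x=a..c. f x) - (c - a) / 6 * (f a + 4 * f d + f c))\<bar>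
      \<le> h ^ 4 * C * ((A + (A + B) / 2) / 2) powr (1 / q)
        + h ^ 4 * C * ((B + (A + B) / 2) / 2) powr (1 / q)"
    using left right unfolding h by simp
  also have "\<dots> = 6 * ((c - a) ^ 4 / 96 * C * (((A + 3 * B) / 4) powr (1 / q) + ((3 * A + B) / 4) powr (1 / q)))"
    unfolding h by (simp add: field_simps)
  finally have "\<bar>(LBINT x=a..c. f x) - (c - a) / 6 * (f a + 4 * f d + f c)\<bar>
      \<le> (c - a) ^ 4 / 96 * C * (((A + 3 * B) / 4) powr (1 / q) + ((3 * A + B) / 4) powr (1 / q))"
    by (simp only: abs_mult) (simp add: mult_ac)
  also have "\<dots> \<le> (c - a) ^ 4 / 96 * (Gamma (2 * p + 1) * Gamma (p + 1) / Gamma (3 * p + 1)) powr (1 / p)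
      * (((A + 3 * B) / 4) powr (1 / q) + ((3 * A + B) / 4) powr (1 / q))"
    unfolding C_def
    by (intro mult_right_mono mult_left_mono powr_mono2 Beta_le_Gamma_ratio)
       (use p in \<open>auto simp: Beta_def\<close>)
  finally show ?thesis
    by (simp add: c_def d_def A_def B_def mult.assoc)
qed

end
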